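(* Let $k$ be a domain, let $n\ge 1$, let $k[\mathbf{x}]=k[x_1,\ldots,x_n]$ be the polynomial ring over $k$, and let $\Gamma$ be a totally ordered additive group. Let $f$ be a nonzero stable $\mathbf{G}_{\rm a}$-invariant of $k[\mathbf{x}]$, and let $S\subset k[\mathbf{x}]\setminus\{0\}$ be a subset such that $\operatorname{trans.deg}_k k[S]=n$. Then for each $\mathbf{w}\in\Gamma^n$ there exists an element $g\in S$ such that $f^{\mathbf{w}}$ is not divisible by $g$ in $k[\mathbf{x}]$.
   Context: "Domain" means commutative integral domain. A totally ordered additive group is an additive (abelian) group $\Gamma$ equipped with a total ordering such that $\alpha\le\beta$ implies $\alpha+\gamma\le\beta+\gamma$ for all $\alpha,\beta,\gamma\in\Gamma$. Initial forms. For $\mathbf{w}=(w_1,\ldots,w_n)\in\Gamma^n$, write $a\cdot\mathbf{w}=a_1w_1+\cdots+a_nw_n$ for $a\in\mathbf{Z}^n$. For nonzero $f=\sum_a u_a x_1^{a_1}\cdots x_n^{a_n}$ with $u_a\in k$, put $\operatorname{supp}(f)=\{a\mid u_a\neq 0\}$ and $\deg_{\mathbf{w}}f=\max\{a\cdot\mathbf{w}\mid a\in\operatorname{supp}(f)\}$; the $\mathbf{w}$-initial form $f^{\mathbf{w}}$ is the sum of the terms $u_ax_1^{a_1}\cdots x_n^{a_n}$ of $f$ with $a\in \operatorname{supp}(f)$ and $a\cdot\mathbf{w}=\deg_{\mathbf{w}}f$. $\mathbf{G}_{\rm a}$-actions. Let $z$ be an indeterminate and, for $m\geq 1$, let $B=k[x_1,\ldots,x_m]$.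 A $\mathbf{G}_{\rm a}$-action on $B$ is a homomorphism of $k$-algebras $\sigma:B\to B[z]=B\otimes_k k[z]$ such that $\pi\circ\sigma=\mathrm{id}_B$ and $(\sigma\otimes \mathrm{id}_{k[z]})\circ\sigma=(\mathrm{id}_B\otimes\mu)\circ\sigma$, where $\pi:B[z]\to B$ is the $B$-algebra homomorphism with $\pi(z)=0$ and $\mu:k[z]\to k[z]\otimes_k k[z]$ is the $k$-algebra homomorphism with $\mu(z)=z\otimes 1+1\otimes z$. The ring of invariants is $B^{\mathbf{G}_{\rm a}}:=\sigma^{-1}(B)$. Stable invariants. For $m\ge n$, write $k[\overline{\mathbf{x}}]=k[x_1,\ldots,x_m]\supseteq k[\mathbf{x}]$. An element $f\in k[\mathbf{x}]$ is a stable $\mathbf{G}_{\rm a}$-invariant of $k[\mathbf{x}]$ if there exist $m\ge n$ and a $\mathbf{G}_{\rm a}$-action on $k[\overline{\mathbf{x}}]$ for which $k[\overline{\mathbf{x}}]^{\mathbf{G}_{\rm a}}$ contains $f$ but does not contain $k[\mathbf{x}]$. $\operatorname{trans.deg}_k k[S]$ is the transcendence degree over $k$ of the $k$-subalgebra $k[S]$ of $k[\mathbf{x}]$ generated by $S$. *)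

theory Defs
  imports
    "HOL-Library.Poly_Mapping"
    "HOL-Library.Extended_Nat"
    "HOL-Computational_Algebra.Polynomial"
begin

text \<open>
  An exponent vector is a finitely supported function from variables to \<^typ>\<open>nat\<close>, and a
  polynomial is a finitely supported function from exponent vectors to coefficients; the ring
  structure is the convolution product of \<^theory>\<open>HOL-Library.Poly_Mapping\<close>.
  The type has all elements of \<open>'v\<close> as variables; a polynomial ring in specific variables is a
  subset of it.
\<close>

type_synonym ('v, 'k) mpoly = "('v \<Rightarrow>\<^sub>0 nat) \<Rightarrow>\<^sub>0 'k"

definition polys :: "'v set \<Rightarrow> ('v, 'k::zero) mpoly set" where
  "polys V = {p. \<forall>a\<in>Poly_Mapping.keys p. Poly_Mapping.keys a \<subseteq> V}"

text \<open>The ring \<open>k[x\<^sub>1, \<dots>, x\<^sub>n]\<close>; the variable \<open>x\<^sub>i\<close> is indexed by the number \<open>i\<close>.\<close>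

abbreviation polyring :: "nat \<Rightarrow> (nat, 'k::zero) mpoly set" where
  "polyring n \<equiv> polys {1..n}"

definition Const :: "'k::zero \<Rightarrow> ('v, 'k) mpoly" where
  "Const c = Poly_Mapping.single 0 c"

definition subst :: "('i \<Rightarrow> ('v, 'k::comm_ring_1) mpoly) \<Rightarrow> ('i, 'k) mpoly \<Rightarrow> ('v, 'k) mpoly" where
  "subst t P = (\<Sum>a\<in>Poly_Mapping.keys P.
     Const (Poly_Mapping.lookup P a) *
     (\<Prod>i\<in>Poly_Mapping.keys a. t i ^ Poly_Mapping.lookup a i))"


subsection \<open>Generated subalgebras and transcendence degree\<close>

inductive_set subalgebra_gen :: "('v, 'k::comm_ring_1) mpoly set \<Rightarrow> ('v, 'k) mpoly set"
  for S where
  const: "Const c \<in> subalgebra_gen S"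
| gen: "g \<in> S \<Longrightarrow> g \<in> subalgebra_gen S"
| add: "p \<in> subalgebra_gen S \<Longrightarrow> q \<in> subalgebra_gen S \<Longrightarrow> p + q \<in> subalgebra_gen S"
| mult: "p \<in> subalgebra_gen S \<Longrightarrow> q \<in> subalgebra_gen S \<Longrightarrow> p * q \<in> subalgebra_gen S"

definition alg_indep :: "'i set \<Rightarrow> ('i \<Rightarrow> ('v, 'k::comm_ring_1) mpoly) \<Rightarrow> bool" where
  "alg_indep I t \<longleftrightarrow> (\<forall>P\<in>polys I. subst t P = 0 \<longrightarrow> P = 0)"

text \<open>
  The supremum of the lengths of finite families in \<open>A\<close> that are algebraically independent over
  the coefficient ring. For a subalgebra \<open>A\<close> over a domain this is the transcendence degree of
  the fraction field of \<open>A\<close> over the fraction field of the coefficient ring.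
\<close>

definition trdeg :: "('v, 'k::comm_ring_1) mpoly set \<Rightarrow> enat" where
  "trdeg A = Sup {enat r | r. \<exists>t. (\<forall>i<r. t i \<in> A) \<and> alg_indep {..<r} t}"


subsection \<open>Initial forms\<close>

text \<open>
  Exponents of polynomials are natural numbers, so \<open>a \<cdot> w\<close> is only needed for such \<open>a\<close>.
  The inner sum is the multiple \<open>a\<^sub>i w\<^sub>i\<close> in the additive group.
\<close>

definition wdot :: "('v \<Rightarrow>\<^sub>0 nat) \<Rightarrow> ('v \<Rightarrow> 'g::comm_monoid_add) \<Rightarrow> 'g" where
  "wdot a w = (\<Sum>i\<in>Poly_Mapping.keys a. \<Sum>_<Poly_Mapping.lookup a i. w i)"

text \<open>Meaningful for nonzero \<open>f\<close> only.\<close>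

definition wdeg :: "('v \<Rightarrow> 'g::linordered_ab_group_add) \<Rightarrow> ('v, 'k::zero) mpoly \<Rightarrow> 'g" where
  "wdeg w f = Max ((\<lambda>a. wdot a w) ` Poly_Mapping.keys f)"

definition initial_form ::
  "('v \<Rightarrow> 'g::linordered_ab_group_add) \<Rightarrow> ('v, 'k::comm_monoid_add) mpoly \<Rightarrow> ('v, 'k) mpoly" where
  "initial_form w f =
     (\<Sum>a\<in>{a\<in>Poly_Mapping.keys f. wdot a w = wdeg w f}.
        Poly_Mapping.single a (Poly_Mapping.lookup f a))"


subsection \<open>Actions of the additive group\<close>

text \<open>
  For a subring \<open>B\<close>, the ring \<open>B[z]\<close> is the set of univariate polynomials with coefficients in
  \<open>B\<close>, and \<open>B \<otimes> k[z] \<otimes> k[z]\<close> is represented by polynomials over \<open>B[z]\<close>: the inner variable is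
  \<open>z \<otimes> 1\<close> and the outer variable is \<open>1 \<otimes> z\<close>. Thus \<open>\<sigma> \<otimes> id\<close> applies \<open>\<sigma>\<close> to the coefficients,
  and \<open>id \<otimes> \<mu>\<close> substitutes \<open>z \<otimes> 1 + 1 \<otimes> z\<close>, that is \<open>[:[:0, 1:], 1:]\<close>, for \<open>z\<close>.
\<close>

definition sigma_tensor_id :: "('b \<Rightarrow> 'b poly) \<Rightarrow> 'b poly \<Rightarrow> 'b::comm_ring_1 poly poly" where
  "sigma_tensor_id \<sigma> q = map_poly \<sigma> q"

definition id_tensor_mu :: "'b poly \<Rightarrow> 'b::comm_ring_1 poly poly" where
  "id_tensor_mu q = poly (map_poly (\<lambda>b. [:[:b:]:]) q) [:[:0, 1:], 1:]"

text \<open>Only the values of \<open>\<sigma>\<close> on \<open>k[x\<^sub>1, \<dots>, x\<^sub>m]\<close> matter.\<close>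

definition Ga_action ::
  "nat \<Rightarrow> ((nat, 'k::comm_ring_1) mpoly \<Rightarrow> (nat, 'k) mpoly poly) \<Rightarrow> bool" where
  "Ga_action m \<sigma> \<longleftrightarrow>
     (\<forall>p\<in>polyring m. \<forall>i. coeff (\<sigma> p) i \<in> polyring m) \<and>
     (\<forall>c. \<sigma> (Const c) = [:Const c:]) \<and>
     (\<forall>p\<in>polyring m. \<forall>q\<in>polyring m. \<sigma> (p + q) = \<sigma> p + \<sigma> q) \<and>
     (\<forall>p\<in>polyring m. \<forall>q\<in>polyring m. \<sigma> (p * q) = \<sigma> p * \<sigma> q) \<and>
     (\<forall>p\<in>polyring m. poly (\<sigma> p) 0 = p) \<and>
     (\<forall>p\<in>polyring m. sigma_tensor_id \<sigma> (\<sigma> p) = id_tensor_mu (\<sigma> p))"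

definition Ga_invariants ::
  "nat \<Rightarrow> ((nat, 'k::comm_ring_1) mpoly \<Rightarrow> (nat, 'k) mpoly poly) \<Rightarrow> (nat, 'k) mpoly set" where
  "Ga_invariants m \<sigma> = {p\<in>polyring m. \<exists>b\<in>polyring m. \<sigma> p = [:b:]}"

definition stable_Ga_invariant :: "nat \<Rightarrow> (nat, 'k::comm_ring_1) mpoly \<Rightarrow> bool" where
  "stable_Ga_invariant n f \<longleftrightarrow> f \<in> polyring n \<and>
     (\<exists>m\<ge>n. \<exists>\<sigma>. Ga_action m \<sigma> \<and> f \<in> Ga_invariants m \<sigma> \<and> \<not> polyring n \<subseteq> Ga_invariants m \<sigma>)"

end

theory Submission
  imports Defs
begin

text \<open>
  Let \<open>\<sigma>: B \<rightarrow> B[z]\<close> be an action that fixes \<open>f\<close> but not every element of \<open>k[x]\<close>. The idea is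
  to pass to leading terms in \<open>\<sigma>\<close>. Give \<open>x\<^sub>i\<close> the weight \<open>w\<^sub>i\<close> and \<open>z\<close> the weight \<open>-\<zeta>\<close>, where
  \<open>\<zeta>\<close> is the smallest element for which every \<open>\<sigma>(x\<^sub>i)\<close>, \<open>i \<le> n\<close>, has weight at most \<open>w\<^sub>i\<close>. It is
  the maximum of the slopes \<open>(b \<cdot> w - w\<^sub>i) / j\<close> over the terms \<open>x\<^sup>b z\<^sup>j\<close>, \<open>j \<ge> 1\<close>, of the
  \<open>\<sigma>(x\<^sub>i)\<close>. Such quotients may not exist in the group, so all weights are first multiplied by a positive
  integer \<open>N\<close> that makes the divisions possible (\<open>common_slope\<close>); this changes no initial form
  (\<open>initial_form_scale\<close>).

  Taking the part of weight \<open>a \<cdot> w\<close> of \<open>\<sigma>(x\<^sup>a)\<close> for every monomial defines a \<open>k\<close>-algebra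
  homomorphism \<open>\<tau>: k[x] \<rightarrow> B[z]\<close> with \<open>\<tau>(p)\<close> equal to \<open>p\<close> at \<open>z = 0\<close>. Comparing parts of weight
  \<open>deg\<^sub>w f\<close> in \<open>\<sigma>(f) = f\<close> gives \<open>\<tau>(f\<^sup>w) = f\<^sup>w\<close> (\<open>initial_form_fixed\<close>), whereas the choice of \<open>\<zeta>\<close>
  gives \<open>\<tau>(x\<^sub>i) \<noteq> x\<^sub>i\<close> for some \<open>i\<close>. An element is fixed by \<open>\<tau>\<close> exactly if its image has degree
  \<open>0\<close> in \<open>z\<close>. Since degrees in \<open>z\<close> add up in products, the algebra of fixed elements contains all
  factors of its nonzero elements (\<open>factor_closed_fixed\<close>), and since a polynomial of positive degree
  in \<open>z\<close> is transcendental over \<open>B\<close>, it is algebraically closed in \<open>k[x]\<close>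
  (\<open>algebraically_closed_fixed\<close>).

  If every \<open>g \<in> S\<close> divided \<open>f\<^sup>w\<close>, then \<open>k[S]\<close> would be fixed. It has transcendence degree \<open>n\<close>, so
  \<open>k[x]\<close> is algebraic over it (\<open>algebraic_over_independent_family\<close>) and would be fixed as well,
  which is a contradiction.
\<close>

section \<open>Polynomials in a set of variables\<close>

abbreviation var :: "'v \<Rightarrow> ('v, 'k::comm_ring_1) mpoly" where
  "var i \<equiv> Poly_Mapping.single (Poly_Mapping.single i 1) 1"

lemma sum_single_lookup: "(\<Sum>a\<in>Poly_Mapping.keys p. Poly_Mapping.single a (Poly_Mapping.lookup p a)) = p"
  by (rule poly_mapping_eqI)
     (simp add: lookup_sum lookup_single when_def in_keys_iff)

lemma exponent_induct [consumes 1, case_names zero var add]: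
  fixes a :: "'v \<Rightarrow>\<^sub>0 nat"
  assumes "Poly_Mapping.keys a \<subseteq> V"
    and zero: "P 0"
    and var: "\<And>i. i \<in> V \<Longrightarrow> P (Poly_Mapping.single i 1)"
    and add: "\<And>a b. Poly_Mapping.keys a \<subseteq> V \<Longrightarrow> Poly_Mapping.keys b \<subseteq> V \<Longrightarrow>
      P a \<Longrightarrow> P b \<Longrightarrow> P (a + b)"
  shows "P a"
proof -
  let ?Q = "\<lambda>a. Poly_Mapping.keys a \<subseteq> V \<and> P a"
  have plus: "?Q (a + b)" if "?Q a" "?Q b" for a b
    using that add keys_add[of a b] by blast
  have power: "?Q (Poly_Mapping.single i e)" if "i \<in> V" for i e
  proof (induction e)
    case 0
    then show ?case using zero by simp
  next
    case (Suc e)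
    have "?Q (Poly_Mapping.single i 1)"
      using that var by simp
    from plus[OF this Suc] show ?case
      by (simp flip: single_add)
  qed
  have "?Q (\<Sum>i\<in>I. Poly_Mapping.single i (Poly_Mapping.lookup a i))" if "finite I" "I \<subseteq> V" for I
    using that
  proof (induction I)
    case empty
    then show ?case using zero by simp
  next
    case (insert i I)
    then show ?case using plus[OF power] by simp
  qed
  from this[of "Poly_Mapping.keys a"] show ?thesis
    using assms(1) by (simp add: sum_single_lookup)
qed

lemma Const_0 [simp]: "Const 0 = 0"
  and Const_1 [simp]: "Const 1 = 1"
  by (simp_all add: Const_def)

lemma Const_add: "Const (c + d) = Const c + Const d"
  and Const_mult: "Const (c * d) = Const c * Const d" for c d :: "'k::comm_ring_1"
  by (simp_all add: Const_def single_add mult_single)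

lemma Const_mult_single: "Const c * Poly_Mapping.single a d = Poly_Mapping.single a (c * d)"
  for c :: "'k::comm_ring_1"
  by (simp add: Const_def mult_single)

lemma lookup_Const_mult: "Poly_Mapping.lookup (Const c * p) a = c * Poly_Mapping.lookup p a"
  for c :: "'k::comm_ring_1"
proof -
  have "Const c * p = (\<Sum>a\<in>Poly_Mapping.keys p. Poly_Mapping.single a (c * Poly_Mapping.lookup p a))"
    by (subst (1) sum_single_lookup[of p, symmetric]) (simp add: sum_distrib_left Const_mult_single)
  then show ?thesis
    by (simp add: lookup_sum lookup_single when_def in_keys_iff)
qed

lemma sum_Const_mult_monomial:
  "(\<Sum>a\<in>Poly_Mapping.keys p. Const (Poly_Mapping.lookup p a) * Poly_Mapping.single a 1) = p"
  for p :: "('v, 'k::comm_ring_1) mpoly"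
  by (simp add: Const_mult_single sum_single_lookup)

lemma mult_eq_sum_singles:
  "p * q = (\<Sum>a\<in>Poly_Mapping.keys p. \<Sum>b\<in>Poly_Mapping.keys q.
     Poly_Mapping.single (a + b) (Poly_Mapping.lookup p a * Poly_Mapping.lookup q b))"
  for p q :: "('v, 'k::comm_ring_1) mpoly"
proof -
  have "p * q = (\<Sum>a\<in>Poly_Mapping.keys p. Poly_Mapping.single a (Poly_Mapping.lookup p a)) *
     (\<Sum>b\<in>Poly_Mapping.keys q. Poly_Mapping.single b (Poly_Mapping.lookup q b))"
    by (simp only: sum_single_lookup)
  then show ?thesis
    by (simp add: sum_product mult_single)
qed

lemma Const_in_polys: "Const c \<in> polys V"
  by (auto simp: polys_def Const_def)

lemma single_in_polys: "Poly_Mapping.keys a \<subseteq> V \<Longrightarrow> Poly_Mapping.single a c \<in> polys V"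
  by (auto simp: polys_def)

lemma zero_in_polys: "0 \<in> polys V"
  by (auto simp: polys_def)

lemma add_in_polys: "p \<in> polys V \<Longrightarrow> q \<in> polys V \<Longrightarrow> p + q \<in> polys V"
  for p q :: "('v, 'k::comm_ring_1) mpoly"
  using keys_add[of p q] unfolding polys_def by blast

lemma mult_in_polys:
  fixes p q :: "('v, 'k::comm_ring_1) mpoly"
  assumes "p \<in> polys V" "q \<in> polys V"
  shows "p * q \<in> polys V"
  unfolding polys_def
proof safe
  fix c i assume "c \<in> Poly_Mapping.keys (p * q)" and i: "i \<in> Poly_Mapping.keys c"
  then obtain a b where ab: "c = a + b" "a \<in> Poly_Mapping.keys p" "b \<in> Poly_Mapping.keys q"
    using keys_mult[of p q] by blast
  then show "i \<in> V"
    using assms keys_add[of a b] i unfolding polys_def by blast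
qed

lemma sum_in_polys: "(\<And>x. x \<in> X \<Longrightarrow> p x \<in> polys V) \<Longrightarrow> (\<Sum>x\<in>X. p x) \<in> polys V"
  for p :: "'x \<Rightarrow> ('v, 'k::comm_ring_1) mpoly"
  by (induction X rule: infinite_finite_induct) (auto intro: zero_in_polys add_in_polys)

lemma polys_mono: "V \<subseteq> W \<Longrightarrow> polys V \<subseteq> polys W"
  unfolding polys_def by blast

lemma polys_induct [consumes 1, case_names Const var add mult]:
  fixes p :: "('v, 'k::comm_ring_1) mpoly"
  assumes "p \<in> polys V"
    and Const: "\<And>c. P (Const c)"
    and var: "\<And>i. i \<in> V \<Longrightarrow> P (var i)"
    and add: "\<And>p q. p \<in> polys V \<Longrightarrow> q \<in> polys V \<Longrightarrow> P p \<Longrightarrow> P q \<Longrightarrow> P (p + q)"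
    and mult: "\<And>p q. p \<in> polys V \<Longrightarrow> q \<in> polys V \<Longrightarrow> P p \<Longrightarrow> P q \<Longrightarrow> P (p * q)"
  shows "P p"
proof -
  have monomial: "P (Poly_Mapping.single a 1)" if "Poly_Mapping.keys a \<subseteq> V" for a
    using that
  proof (induction rule: exponent_induct)
    case zero
    then show ?case using Const[of 1] by (simp add: Const_def)
  next
    case (var i)
    then show ?case by (rule assms(3))
  next
    case (add a b)
    then show ?case
      using mult[of "Poly_Mapping.single a 1" "Poly_Mapping.single b 1"]
      by (simp add: mult_single single_in_polys)
  qed
  have monomial_term: "P (Const (Poly_Mapping.lookup p a) * Poly_Mapping.single a 1)"
    and term_in: "Const (Poly_Mapping.lookup p a) * Poly_Mapping.single a 1 \<in> polys V"
    if "a \<in> Poly_Mapping.keys p" for a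
  proof -
    have a: "Poly_Mapping.keys a \<subseteq> V" using that assms(1) by (auto simp: polys_def)
    show "P (Const (Poly_Mapping.lookup p a) * Poly_Mapping.single a 1)"
      by (intro mult Const_in_polys single_in_polys Const monomial a)
    show "Const (Poly_Mapping.lookup p a) * Poly_Mapping.single a 1 \<in> polys V"
      by (intro mult_in_polys Const_in_polys single_in_polys a)
  qed
  have "P (\<Sum>a\<in>A. Const (Poly_Mapping.lookup p a) * Poly_Mapping.single a 1)"
    if "finite A" "A \<subseteq> Poly_Mapping.keys p" for A
    using that
  proof (induction A)
    case empty
    then show ?case using Const[of 0] by simp
  next
    case (insert a A)
    have "P (Const (Poly_Mapping.lookup p a) * Poly_Mapping.single a 1 +
      (\<Sum>a\<in>A. Const (Poly_Mapping.lookup p a) * Poly_Mapping.single a 1))"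
      using insert by (intro add sum_in_polys monomial_term term_in) auto
    then show ?case using insert by simp
  qed
  from this[of "Poly_Mapping.keys p"] show ?thesis
    by (simp only: sum_Const_mult_monomial finite_keys)
qed


section \<open>Algebraic dependence\<close>

text \<open>
  Gaussian elimination without division: multiplying by the pivot instead of dividing by it keeps
  all coefficients in the domain.
\<close>

lemma homogeneous_system_nontrivial_solution:
  fixes M :: "'i \<Rightarrow> 'j \<Rightarrow> 'k::idom"
  assumes "finite J" "finite I" "card J < card I"
  shows "\<exists>c. (\<exists>i\<in>I. c i \<noteq> 0) \<and> (\<forall>j\<in>J. (\<Sum>i\<in>I. c i * M i j) = 0)"
  using assms
proof (induction J arbitrary: I M)
  case empty
  then obtain i where "i \<in> I" by fastforce
  then show ?case by (intro exI[of _ "\<lambda>_. 1"]) auto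
next
  case (insert j J)
  show ?case
  proof (cases "\<forall>i\<in>I. M i j = 0")
    case True
    have "card J < card I" using insert by simp
    with insert.IH[of I M] insert.prems
    obtain c where "\<exists>i\<in>I. c i \<noteq> 0" "\<forall>j\<in>J. (\<Sum>i\<in>I. c i * M i j) = 0"
      by blast
    then show ?thesis using True by (intro exI[of _ c]) auto
  next
    case False
    then obtain p where p: "p \<in> I" "M p j \<noteq> 0" by blast
    define I' where "I' = I - {p}"
    have I': "finite I'" "card J < card I'" "I = insert p I'" "p \<notin> I'"
      using insert p by (auto simp: I'_def)
    from insert.IH[OF I'(1,2), of "\<lambda>i k. M p j * M i k - M i j * M p k"]
    obtain c where c: "\<exists>i\<in>I'. c i \<noteq> 0"
      and c0: "\<And>k. k \<in> J \<Longrightarrow> (\<Sum>i\<in>I'. c i * (M p j * M i k - M i j * M p k)) = 0"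
      by blast
    \<comment> \<open>The coefficient of the pivot is chosen to solve equation \<open>j\<close>, after scaling the others by \<open>M p j\<close>.\<close>
    define b where "b i = (if i = p then - (\<Sum>i\<in>I'. c i * M i j) else c i * M p j)" for i
    have split: "(\<Sum>i\<in>I. b i * M i k) = (\<Sum>i\<in>I'. c i * (M p j * M i k - M i j * M p k))" for k
    proof -
      have "(\<Sum>i\<in>I'. b i * M i k) = (\<Sum>i\<in>I'. c i * M p j * M i k)"
        using I'(4) by (intro sum.cong) (auto simp: b_def)
      then have "(\<Sum>i\<in>I. b i * M i k) = - (\<Sum>i\<in>I'. c i * M i j) * M p k + (\<Sum>i\<in>I'. c i * M p j * M i k)"
        using I' by (simp add: b_def)
      then show ?thesis
        by (simp add: sum_distrib_right right_diff_distrib sum_subtractf mult.assoc)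
    qed
    have "(\<Sum>i\<in>I. b i * M i k) = 0" if "k \<in> insert j J" for k
      using that c0 unfolding split by (auto simp: mult.commute)
    moreover have "\<exists>i\<in>I. b i \<noteq> 0"
      using c p I' by (auto simp: b_def)
    ultimately show ?thesis by blast
  qed
qed

definition exponent_box :: "'v set \<Rightarrow> nat \<Rightarrow> ('v \<Rightarrow>\<^sub>0 nat) set" where
  "exponent_box V d = {a. Poly_Mapping.keys a \<subseteq> V \<and> (\<forall>i. Poly_Mapping.lookup a i \<le> d)}"

text \<open>
  Splitting off the exponent of one variable turns the box into a product of an interval with a
  smaller box.
\<close>

lemma exponent_box_card:
  fixes V :: "'v set"
  assumes "finite V"
  shows "finite (exponent_box V d)" "card (exponent_box V d) = (d + 1) ^ card V"
proof -
  have "finite (exponent_box V d) \<and> card (exponent_box V d) = (d + 1) ^ card V"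
    using assms
  proof (induction V)
    case empty
    have "exponent_box {} d = {0 :: 'v \<Rightarrow>\<^sub>0 nat}"
      by (auto simp: exponent_box_def)
    then show ?case by simp
  next
    case (insert i V)
    let ?h = "\<lambda>(e, a). Poly_Mapping.single i e + a"
    have outside: "Poly_Mapping.lookup a i = 0" if "a \<in> exponent_box V d" for a
      using that insert.hyps by (auto simp: exponent_box_def in_keys_iff)
    have inj: "inj_on ?h ({..d} \<times> exponent_box V d)"
    proof (rule inj_onI, clarify)
      fix e a e' a'
      assume a: "a \<in> exponent_box V d" "a' \<in> exponent_box V d"
        and eq: "Poly_Mapping.single i e + a = Poly_Mapping.single i e' + a'"
      have "e = e'"
        using arg_cong[OF eq, of "\<lambda>b. Poly_Mapping.lookup b i"] a
        by (simp add: lookup_add outside)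
      then show "e = e' \<and> a = a'" using eq by simp
    qed
    have img: "?h ` ({..d} \<times> exponent_box V d) = exponent_box (insert i V) d"
    proof (intro equalityI subsetI)
      fix b assume "b \<in> ?h ` ({..d} \<times> exponent_box V d)"
      then obtain e a where b: "b = Poly_Mapping.single i e + a" "e \<le> d" "a \<in> exponent_box V d"
        by auto
      have "Poly_Mapping.lookup b j \<le> d" for j
        using b outside[OF b(3)] by (cases "j = i") (auto simp: lookup_add lookup_single exponent_box_def)
      moreover have "Poly_Mapping.keys b \<subseteq> insert i V"
        using b keys_add[of "Poly_Mapping.single i e" a]
        by (auto simp: exponent_box_def split: if_splits)
      ultimately show "b \<in> exponent_box (insert i V) d"
        by (simp add: exponent_box_def)
    next
      fix b assume b: "b \<in> exponent_box (insert i V) d"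
      define a where "a = Poly_Mapping.update i 0 b"
      have lookup_a: "Poly_Mapping.lookup a j = (if j = i then 0 else Poly_Mapping.lookup b j)" for j
        by (simp add: a_def lookup_update)
      have "b = Poly_Mapping.single i (Poly_Mapping.lookup b i) + a"
        by (rule poly_mapping_eqI) (auto simp: lookup_add lookup_single lookup_a when_def)
      moreover have "a \<in> exponent_box V d"
        using b unfolding exponent_box_def subset_iff
        by (auto simp: lookup_a in_keys_iff split: if_splits)
      moreover have "Poly_Mapping.lookup b i \<le> d"
        using b by (simp add: exponent_box_def)
      ultimately show "b \<in> ?h ` ({..d} \<times> exponent_box V d)"
        by force
    qed
    show ?case
      using insert img card_image[OF inj] finite_imageI[of "{..d} \<times> exponent_box V d" ?h]
      by (simp add: card_cartesian_product)
  qed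
  then show "finite (exponent_box V d)" "card (exponent_box V d) = (d + 1) ^ card V"
    by auto
qed

definition box_bounded :: "'v set \<Rightarrow> nat \<Rightarrow> ('v, 'k::zero) mpoly \<Rightarrow> bool" where
  "box_bounded V D p \<longleftrightarrow> Poly_Mapping.keys p \<subseteq> exponent_box V D"

lemma box_bounded_mono: "box_bounded V D p \<Longrightarrow> D \<le> E \<Longrightarrow> box_bounded V E p"
  unfolding box_bounded_def exponent_box_def by (blast intro: le_trans)

lemma box_bounded_one: "box_bounded V 0 (1 :: ('v, 'k::comm_ring_1) mpoly)"
  by (auto simp: box_bounded_def exponent_box_def)

lemma box_bounded_mult:
  fixes p q :: "('v, 'k::comm_ring_1) mpoly"
  assumes "box_bounded V D p" "box_bounded V E q"
  shows "box_bounded V (D + E) (p * q)"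
  unfolding box_bounded_def
proof
  fix c assume "c \<in> Poly_Mapping.keys (p * q)"
  then obtain a b where ab: "c = a + b" "a \<in> Poly_Mapping.keys p" "b \<in> Poly_Mapping.keys q"
    using keys_mult[of p q] by blast
  then have "a \<in> exponent_box V D" "b \<in> exponent_box V E"
    using assms by (auto simp: box_bounded_def)
  then show "c \<in> exponent_box V (D + E)"
    using keys_add[of a b] unfolding ab(1) exponent_box_def
    by (auto simp: lookup_add intro: add_mono)
qed

lemma box_bounded_power: "box_bounded V D p \<Longrightarrow> box_bounded V (e * D) (p ^ e)"
  for p :: "('v, 'k::comm_ring_1) mpoly"
  by (induction e) (auto intro: box_bounded_one dest: box_bounded_mult)

lemma box_bounded_prod:
  fixes p :: "'x \<Rightarrow> ('v, 'k::comm_ring_1) mpoly"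
  shows "(\<And>x. x \<in> X \<Longrightarrow> box_bounded V E (p x)) \<Longrightarrow> box_bounded V (card X * E) (\<Prod>x\<in>X. p x)"
proof (induction X rule: infinite_finite_induct)
  case (insert x X)
  then show ?case using box_bounded_mult[of V E "p x" "card X * E" "prod p X"] by simp
qed (auto intro: box_bounded_one)

lemma box_bounded_family_ex:
  fixes p :: "'x \<Rightarrow> ('v, 'k::zero) mpoly"
  assumes "finite X" "\<And>x. x \<in> X \<Longrightarrow> p x \<in> polys V"
  shows "\<exists>D. \<forall>x\<in>X. box_bounded V D (p x)"
proof -
  let ?E = "\<Union>x\<in>X. \<Union>a\<in>Poly_Mapping.keys (p x). Poly_Mapping.lookup a ` Poly_Mapping.keys a"
  have fin: "finite ?E" using assms(1) by auto
  have "Poly_Mapping.lookup a i \<le> Max (insert 0 ?E)"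
    if "x \<in> X" "a \<in> Poly_Mapping.keys (p x)" for x a i
  proof (cases "i \<in> Poly_Mapping.keys a")
    case True
    then show ?thesis using that fin by (intro Max_ge) auto
  qed (simp add: in_keys_iff)
  moreover have "Poly_Mapping.keys a \<subseteq> V" if "x \<in> X" "a \<in> Poly_Mapping.keys (p x)" for x a
    using assms(2) that by (auto simp: polys_def)
  ultimately show ?thesis
    unfolding box_bounded_def exponent_box_def by blast
qed

abbreviation power_product :: "('i \<Rightarrow> ('v, 'k::comm_ring_1) mpoly) \<Rightarrow> ('i \<Rightarrow>\<^sub>0 nat) \<Rightarrow> ('v, 'k) mpoly" where
  "power_product t a \<equiv> \<Prod>i\<in>Poly_Mapping.keys a. t i ^ Poly_Mapping.lookup a i"

lemma one_in_subalgebra_gen: "1 \<in> subalgebra_gen S"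
  using subalgebra_gen.const[of 1 S] by simp

lemma power_in_subalgebra_gen: "p \<in> subalgebra_gen S \<Longrightarrow> p ^ e \<in> subalgebra_gen S"
  by (induction e) (auto intro: one_in_subalgebra_gen subalgebra_gen.mult)

lemma prod_in_subalgebra_gen:
  "(\<And>x. x \<in> X \<Longrightarrow> p x \<in> subalgebra_gen S) \<Longrightarrow> (\<Prod>x\<in>X. p x) \<in> subalgebra_gen S"
  by (induction X rule: infinite_finite_induct)
     (auto intro: one_in_subalgebra_gen subalgebra_gen.mult)

lemma zero_in_subalgebra_gen: "0 \<in> subalgebra_gen S"
  using subalgebra_gen.const[of 0 S] by simp

lemma sum_in_subalgebra_gen:
  "(\<And>x. x \<in> X \<Longrightarrow> p x \<in> subalgebra_gen S) \<Longrightarrow> (\<Sum>x\<in>X. p x) \<in> subalgebra_gen S"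
  by (induction X rule: infinite_finite_induct)
     (auto intro: zero_in_subalgebra_gen subalgebra_gen.add)

text \<open>
  A dimension count. The \<open>(d + 1)\<^sup>n\<^sup>+\<^sup>1\<close> products of powers of the \<open>t\<^sub>i\<close> and \<open>x\<close> with exponents at
  most \<open>d\<close> lie in the span of at most \<open>(C (d + 1))\<^sup>n\<close> monomials, where \<open>C\<close> does not depend on
  \<open>d\<close>. For \<open>d = C\<^sup>n\<close> they must be linearly dependent. Sorting the relation by powers of \<open>x\<close> gives
  \<open>q\<close>; independence of the \<open>t\<^sub>i\<close> is what makes \<open>q\<close> nonzero. The coefficients of \<open>q\<close> are placed in
  the algebra generated by the \<open>t\<^sub>i\<close>, because fixed elements form such an algebra.
\<close>

lemma algebraic_over_independent_family:
  fixes t :: "nat \<Rightarrow> ('v, 'k::idom) mpoly"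
  assumes V: "finite V" "card V = n"
    and t: "\<And>i. i < n \<Longrightarrow> t i \<in> polys V" "alg_indep {..<n} t"
    and x: "x \<in> polys V"
  shows "\<exists>q. q \<noteq> 0 \<and> (\<forall>j. coeff q j \<in> subalgebra_gen (t ` {..<n})) \<and> poly q x = 0"
proof -
  obtain D0 where D0: "\<forall>y\<in>insert x (t ` {..<n}). box_bounded V D0 y"
    using box_bounded_family_ex[of "insert x (t ` {..<n})" "\<lambda>y. y" V] t x by auto
  \<comment> \<open>The successor makes \<open>C\<close> positive.\<close>
  define D where "D = Suc D0"
  have D: "box_bounded V D x" "\<And>i. i < n \<Longrightarrow> box_bounded V D (t i)"
    using D0 box_bounded_mono[of V D0 _ D] by (auto simp: D_def)
  define C where "C = (n + 1) * D"
  define d where "d = C ^ n"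
  define A where "A = exponent_box {..<n} d"
  define J where "J = exponent_box V (C * d)"
  define I where "I = A \<times> {..d}"
  have A: "finite A" "card A = (d + 1) ^ n"
    using exponent_box_card[of "{..<n}" d] by (auto simp: A_def)
  have J: "finite J" "card J = (C * d + 1) ^ n"
    using exponent_box_card[of V "C * d"] V by (auto simp: J_def)
  have I: "finite I" "card I = (d + 1) ^ n * (d + 1)"
    using A by (auto simp: I_def card_cartesian_product)
  have "card J \<le> (C * (d + 1)) ^ n"
    unfolding J by (intro power_mono) (auto simp: C_def D_def)
  also have "\<dots> = (d + 1) ^ n * d"
    by (simp only: power_mult_distrib d_def mult.commute)
  also have "\<dots> < card I"
    unfolding I by (intro mult_strict_left_mono) auto
  finally have "card J < card I" .
  from homogeneous_system_nontrivial_solution[OF J(1) I(1) this,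
      of "\<lambda>(a, j) b. Poly_Mapping.lookup (power_product t a * x ^ j) b"]
  obtain c where c: "\<exists>i\<in>I. c i \<noteq> 0"
    and c0: "\<And>b. b \<in> J \<Longrightarrow>
      (\<Sum>(a, j)\<in>I. c (a, j) * Poly_Mapping.lookup (power_product t a * x ^ j) b) = 0"
    by (force simp: case_prod_beta)
  have bounded: "box_bounded V (C * d) (power_product t a * x ^ j)" if "(a, j) \<in> I" for a j
  proof -
    have a: "Poly_Mapping.keys a \<subseteq> {..<n}" "\<And>i. Poly_Mapping.lookup a i \<le> d" and "j \<le> d"
      using that by (auto simp: I_def A_def exponent_box_def)
    have "box_bounded V (d * D) (t i ^ Poly_Mapping.lookup a i)" if "i \<in> Poly_Mapping.keys a" for i
      using a that by (intro box_bounded_mono[OF box_bounded_power[OF D(2)]]) auto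
    then have "box_bounded V (card (Poly_Mapping.keys a) * (d * D)) (power_product t a)"
      by (rule box_bounded_prod)
    moreover have "card (Poly_Mapping.keys a) \<le> n"
      using card_mono[OF _ a(1)] by simp
    ultimately have "box_bounded V (n * (d * D)) (power_product t a)"
      by (elim box_bounded_mono) auto
    moreover have "box_bounded V (d * D) (x ^ j)"
      using \<open>j \<le> d\<close> by (intro box_bounded_mono[OF box_bounded_power[OF D(1)]]) auto
    ultimately have "box_bounded V (n * (d * D) + d * D) (power_product t a * x ^ j)"
      by (rule box_bounded_mult)
    then show ?thesis by (simp add: C_def algebra_simps)
  qed
  have relation: "(\<Sum>(a, j)\<in>I. Const (c (a, j)) * (power_product t a * x ^ j)) = 0" (is "?s = 0")
  proof (rule poly_mapping_eqI)
    fix b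
    have *: "Poly_Mapping.lookup ?s b =
      (\<Sum>(a, j)\<in>I. c (a, j) * Poly_Mapping.lookup (power_product t a * x ^ j) b)"
      by (simp add: lookup_sum lookup_Const_mult case_prod_beta)
    show "Poly_Mapping.lookup ?s b = Poly_Mapping.lookup 0 b"
    proof (cases "b \<in> J")
      case True
      then show ?thesis using c0 * by simp
    next
      case False
      then have "Poly_Mapping.lookup (power_product t a * x ^ j) b = 0" if "(a, j) \<in> I" for a j
        using bounded[OF that] by (auto simp: box_bounded_def J_def in_keys_iff)
      then show ?thesis unfolding * by (auto intro!: sum.neutral)
    qed
  qed
  define r where "r j = (\<Sum>a\<in>A. Const (c (a, j)) * power_product t a)" for j
  define q where "q = (\<Sum>j\<le>d. monom (r j) j)"
  have coeff_q: "coeff q j = (if j \<le> d then r j else 0)" for j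
    by (simp add: q_def coeff_sum)
  have "coeff q j \<in> subalgebra_gen (t ` {..<n})" for j
  proof -
    have "r j \<in> subalgebra_gen (t ` {..<n})"
      unfolding r_def
      by (intro sum_in_subalgebra_gen subalgebra_gen.mult subalgebra_gen.const
          prod_in_subalgebra_gen power_in_subalgebra_gen subalgebra_gen.gen)
        (auto simp: A_def exponent_box_def)
    then show ?thesis by (simp add: coeff_q zero_in_subalgebra_gen)
  qed
  moreover have "poly q x = 0"
  proof -
    have "poly q x = (\<Sum>j\<le>d. \<Sum>a\<in>A. Const (c (a, j)) * (power_product t a * x ^ j))"
      by (simp add: q_def r_def poly_sum poly_monom sum_distrib_right mult.assoc)
    also have "\<dots> = (\<Sum>a\<in>A. \<Sum>j\<le>d. Const (c (a, j)) * (power_product t a * x ^ j))"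
      by (rule sum.swap)
    also have "\<dots> = ?s"
      unfolding I_def using A by (subst sum.cartesian_product) simp
    finally show ?thesis using relation by simp
  qed
  moreover have "q \<noteq> 0"
  proof -
    obtain a0 j0 where 0: "a0 \<in> A" "j0 \<le> d" "c (a0, j0) \<noteq> 0"
      using c by (auto simp: I_def)
    define P where "P = (\<Sum>a\<in>A. Poly_Mapping.single a (c (a, j0)))"
    have lookup_P: "Poly_Mapping.lookup P a = (if a \<in> A then c (a, j0) else 0)" for a
      using A by (simp add: P_def lookup_sum lookup_single when_def)
    have keys_P: "Poly_Mapping.keys P \<subseteq> A"
      by (auto simp: in_keys_iff lookup_P split: if_splits)
    have "subst t P = (\<Sum>a\<in>A. Const (Poly_Mapping.lookup P a) * power_product t a)"
      unfolding subst_def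
      by (rule sum.mono_neutral_left) (use A keys_P in \<open>auto simp: in_keys_iff\<close>)
    then have "subst t P = r j0"
      by (simp add: r_def lookup_P)
    moreover have "P \<in> polys {..<n}"
      using keys_P by (auto simp: polys_def A_def exponent_box_def)
    moreover have "P \<noteq> 0"
      using 0 lookup_P[of a0] by auto
    ultimately have "r j0 \<noteq> 0"
      using t(2) by (auto simp: alg_indep_def)
    then show ?thesis
      using 0 coeff_q[of j0] by auto
  qed
  ultimately show ?thesis by blast
qed

text \<open>
  A supremum of naturals with a finite value is attained as soon as that value is positive; the
  supremum of the empty set is \<open>0\<close>.
\<close>

lemma trdeg_attained:
  assumes "trdeg A = enat n" "n \<ge> 1"
  shows "\<exists>t. (\<forall>i<n. t i \<in> A) \<and> alg_indep {..<n} t"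
proof -
  define R :: "nat set" where "R = {r. \<exists>t. (\<forall>i<r. t i \<in> A) \<and> alg_indep {..<r} t}"
  have trdeg: "trdeg A = Sup (enat ` R)"
    unfolding trdeg_def by (rule arg_cong[of _ _ Sup]) (auto simp: R_def)
  have "\<exists>r\<in>R. n \<le> r"
  proof (rule ccontr)
    assume none: "\<not> ?thesis"
    have "Sup (enat ` R) \<le> enat (n - 1)"
    proof (rule Sup_least)
      fix e assume "e \<in> enat ` R"
      then obtain r where r: "r \<in> R" "e = enat r" by (rule imageE)
      then have "r < n" using none by (meson not_less)
      then show "e \<le> enat (n - 1)" using r(2) by simp
    qed
    then show False using assms trdeg by simp
  qed
  then obtain r where r: "r \<in> R" "n \<le> r" by blast
  have "enat r \<le> enat n"
    unfolding assms(1)[symmetric] trdeg using r by (intro Sup_upper imageI)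
  then have "r = n" using r by simp
  then show ?thesis using r by (simp add: R_def)
qed


section \<open>Weights and homogeneous parts\<close>

definition nsmult :: "nat \<Rightarrow> 'g::comm_monoid_add \<Rightarrow> 'g" where
  "nsmult m g = (\<Sum>_<m. g)"

lemma nsmult_0 [simp]: "nsmult 0 g = 0"
  and nsmult_1 [simp]: "nsmult (Suc 0) g = g"
  by (simp_all add: nsmult_def)

lemma nsmult_add: "nsmult (m + l) g = nsmult m g + nsmult l g"
  by (induction l) (simp_all add: nsmult_def add.assoc)

lemma nsmult_diff: "nsmult m (g - h) = nsmult m g - nsmult m h" for g :: "'g::ab_group_add"
  unfolding nsmult_def by (rule sum_subtractf)

lemma nsmult_sum: "nsmult m (\<Sum>x\<in>X. g x) = (\<Sum>x\<in>X. nsmult m (g x))"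
  unfolding nsmult_def by (rule sum.swap)

lemma nsmult_nsmult: "nsmult m (nsmult l g) = nsmult (m * l) g"
proof (induction m)
  case (Suc m)
  then show ?case using nsmult_add[of 1 m "nsmult l g"] by (simp add: nsmult_add)
qed simp

lemma nsmult_mono: "g \<le> h \<Longrightarrow> nsmult m g \<le> nsmult m h" for g :: "'g::linordered_ab_group_add"
  unfolding nsmult_def by (rule sum_mono)

lemma nsmult_less: "g < h \<Longrightarrow> 0 < m \<Longrightarrow> nsmult m g < nsmult m h" for g :: "'g::linordered_ab_group_add"
  unfolding nsmult_def by (rule sum_strict_mono) auto

lemma wdot_eq: "wdot a w = (\<Sum>i\<in>Poly_Mapping.keys a. nsmult (Poly_Mapping.lookup a i) (w i))"
  by (simp add: wdot_def nsmult_def)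

lemma wdot_zero [simp]: "wdot 0 w = 0"
  by (simp add: wdot_eq)

lemma wdot_add: "wdot (a + b) w = wdot a w + wdot b w"
  unfolding wdot_eq by (rule setsum_keys_plus_distrib) (simp_all add: nsmult_add)

lemma wdot_var [simp]: "wdot (Poly_Mapping.single i (Suc 0)) w = w i"
  by (simp add: wdot_eq)

lemma wdot_scale: "wdot a (\<lambda>i. nsmult N (w i)) = nsmult N (wdot a w)"
  by (simp add: wdot_eq nsmult_sum nsmult_nsmult mult.commute)

definition hom_part ::
  "('v \<Rightarrow> 'g::linordered_ab_group_add) \<Rightarrow> 'g \<Rightarrow> ('v, 'k::comm_monoid_add) mpoly \<Rightarrow> ('v, 'k) mpoly" where
  "hom_part w d p = (\<Sum>a\<in>{a\<in>Poly_Mapping.keys p. wdot a w = d}.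
     Poly_Mapping.single a (Poly_Mapping.lookup p a))"

lemma initial_form_eq_hom_part: "initial_form w f = hom_part w (wdeg w f) f"
  by (simp add: initial_form_def hom_part_def)

lemma lookup_hom_part:
  "Poly_Mapping.lookup (hom_part w d p) a = (if wdot a w = d then Poly_Mapping.lookup p a else 0)"
  by (auto simp: hom_part_def lookup_sum lookup_single when_def in_keys_iff)

lemma hom_part_zero [simp]: "hom_part w d 0 = 0"
  by (simp add: hom_part_def)

lemma hom_part_add: "hom_part w d (p + q) = hom_part w d p + hom_part w d q"
  by (rule poly_mapping_eqI) (simp add: lookup_hom_part lookup_add)

lemma hom_part_sum: "hom_part w d (\<Sum>x\<in>X. p x) = (\<Sum>x\<in>X. hom_part w d (p x))"
  by (induction X rule: infinite_finite_induct) (simp_all add: hom_part_add)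

lemma hom_part_single:
  "hom_part w d (Poly_Mapping.single a c) = (if wdot a w = d then Poly_Mapping.single a c else 0)"
  by (rule poly_mapping_eqI) (auto simp: lookup_hom_part lookup_single when_def)

lemma hom_part_Const_mult: "hom_part w d (Const c * p) = Const c * hom_part w d p"
  for p :: "('v, 'k::comm_ring_1) mpoly"
  by (rule poly_mapping_eqI) (simp add: lookup_hom_part lookup_Const_mult)

definition weight_le :: "('v \<Rightarrow> 'g::linordered_ab_group_add) \<Rightarrow> 'g \<Rightarrow> ('v, 'k::zero) mpoly \<Rightarrow> bool" where
  "weight_le w d p \<longleftrightarrow> (\<forall>a\<in>Poly_Mapping.keys p. wdot a w \<le> d)"

lemma weight_le_zero [simp]: "weight_le w d 0"
  by (simp add: weight_le_def)

lemma weight_le_add: "weight_le w d p \<Longrightarrow> weight_le w d q \<Longrightarrow> weight_le w d (p + q)"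
  for p :: "('v, 'k::comm_ring_1) mpoly"
  using keys_add[of p q] by (auto simp: weight_le_def)

lemma weight_le_sum: "(\<And>x. x \<in> X \<Longrightarrow> weight_le w d (p x)) \<Longrightarrow> weight_le w d (\<Sum>x\<in>X. p x)"
  for p :: "'x \<Rightarrow> ('v, 'k::comm_ring_1) mpoly"
  by (induction X rule: infinite_finite_induct) (auto intro: weight_le_add)

lemma weight_le_mult:
  fixes p q :: "('v, 'k::comm_ring_1) mpoly"
  assumes "weight_le w d p" "weight_le w e q"
  shows "weight_le w (d + e) (p * q)"
  unfolding weight_le_def
proof
  fix c assume "c \<in> Poly_Mapping.keys (p * q)"
  then obtain a b where "c = a + b" "a \<in> Poly_Mapping.keys p" "b \<in> Poly_Mapping.keys q"
    using keys_mult[of p q] by blast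
  then show "wdot c w \<le> d + e"
    using assms by (simp add: weight_le_def wdot_add add_mono)
qed

text \<open>
  The weight of a product of two terms is the sum of theirs. When the bounds hold it reaches
  \<open>d + e\<close> only if both terms reach their bounds, so no other terms contribute.
\<close>

lemma hom_part_mult:
  fixes p q :: "('v, 'k::comm_ring_1) mpoly"
  assumes "weight_le w d p" "weight_le w e q"
  shows "hom_part w (d + e) (p * q) = hom_part w d p * hom_part w e q"
proof -
  have *: "wdot (a + b) w = d + e \<longleftrightarrow> wdot a w = d \<and> wdot b w = e"
    if "a \<in> Poly_Mapping.keys p" "b \<in> Poly_Mapping.keys q" for a b
  proof -
    have "wdot a w \<le> d" "wdot b w \<le> e"
      using assms that by (auto simp: weight_le_def)
    then show ?thesis
      by (auto simp: wdot_add dest: add_less_le_mono add_le_less_mono simp: order_le_less)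
  qed
  have part: "hom_part w d p = (\<Sum>a\<in>Poly_Mapping.keys p.
      if wdot a w = d then Poly_Mapping.single a (Poly_Mapping.lookup p a) else 0)" for d and p :: "('v, 'k) mpoly"
    by (simp add: hom_part_def sum.inter_filter)
  show ?thesis
    unfolding mult_eq_sum_singles[of p q] part[of d p] part[of e q]
    by (auto simp: hom_part_sum hom_part_single sum_product mult_single * intro!: sum.cong)
qed

lemma initial_form_nonzero:
  assumes "f \<noteq> 0"
  shows "initial_form w f \<noteq> 0"
proof -
  have "wdeg w f \<in> (\<lambda>a. wdot a w) ` Poly_Mapping.keys f"
    unfolding wdeg_def using assms by (intro Max_in) auto
  then obtain a where "a \<in> Poly_Mapping.keys f" "wdot a w = wdeg w f" by auto
  then have "Poly_Mapping.lookup (initial_form w f) a \<noteq> 0"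
    by (simp add: initial_form_eq_hom_part lookup_hom_part in_keys_iff)
  then show ?thesis by auto
qed

lemma wdot_le_wdeg: "a \<in> Poly_Mapping.keys f \<Longrightarrow> wdot a w \<le> wdeg w f"
  unfolding wdeg_def by (intro Max_ge) auto

text \<open>
  Multiplication by a positive integer is strictly increasing on an ordered group, so it preserves
  which terms have maximal weight.
\<close>

lemma initial_form_scale:
  fixes w :: "'v \<Rightarrow> 'g::linordered_ab_group_add"
  assumes "N > 0"
  shows "initial_form (\<lambda>i. nsmult N (w i)) f = initial_form w f"
proof (cases "f = 0")
  case False
  have "strict_mono (nsmult N :: 'g \<Rightarrow> 'g)"
    using nsmult_less[OF _ assms] by (intro strict_monoI)
  then have "wdeg (\<lambda>i. nsmult N (w i)) f = nsmult N (wdeg w f)"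
    and "inj (nsmult N :: 'g \<Rightarrow> 'g)"
    using False mono_Max_commute[of "nsmult N" "(\<lambda>a. wdot a w) ` Poly_Mapping.keys f"]
    unfolding wdeg_def
    by (simp_all add: wdot_scale strict_mono_mono image_image strict_mono_imp_inj_on)
  moreover have "nsmult N g = nsmult N h \<longleftrightarrow> g = h" for g h :: 'g
    using calculation(2) injD[of "nsmult N" g h] by auto
  ultimately show ?thesis
    by (simp only: initial_form_def wdot_scale)
qed (simp add: initial_form_def)

text \<open>
  The indeterminate of \<open>B[z]\<close> has weight \<open>- z\<close>, so a term of \<open>F\<close> with \<open>j\<close>-th power of the
  indeterminate has weight at most \<open>d\<close> if its coefficient has weight at most \<open>d + j z\<close>.
\<close>

definition zweight_le ::
  "('v \<Rightarrow> 'g::linordered_ab_group_add) \<Rightarrow> 'g \<Rightarrow> 'g \<Rightarrow> ('v, 'k::zero) mpoly poly \<Rightarrow> bool" where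
  "zweight_le w z d F \<longleftrightarrow> (\<forall>j. weight_le w (d + nsmult j z) (coeff F j))"

definition zpart ::
  "('v \<Rightarrow> 'g::linordered_ab_group_add) \<Rightarrow> 'g \<Rightarrow> 'g \<Rightarrow> ('v, 'k::comm_ring_1) mpoly poly \<Rightarrow> ('v, 'k) mpoly poly" where
  "zpart w z d F = (\<Sum>j\<le>degree F. monom (hom_part w (d + nsmult j z) (coeff F j)) j)"

lemma coeff_zpart: "coeff (zpart w z d F) j = hom_part w (d + nsmult j z) (coeff F j)"
  by (simp add: zpart_def coeff_sum coeff_eq_0)

lemma zpart_sum: "zpart w z d (\<Sum>x\<in>X. F x) = (\<Sum>x\<in>X. zpart w z d (F x))"
  by (rule poly_eqI) (simp add: coeff_zpart coeff_sum hom_part_sum)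

lemma zpart_smult_Const: "zpart w z d (smult (Const c) F) = smult (Const c) (zpart w z d F)"
  by (rule poly_eqI) (simp add: coeff_zpart hom_part_Const_mult)

lemma zpart_const_poly: "zpart w z d [:p:] = [:hom_part w d p:]"
  by (rule poly_eqI) (simp add: coeff_zpart coeff_pCons split: nat.split)

lemma zpart_eq_0:
  assumes "zweight_le w z d F" "d < e"
  shows "zpart w z e F = 0"
proof (rule poly_eqI, rule poly_mapping_eqI)
  fix j a
  have "Poly_Mapping.lookup (coeff F j) a = 0" if "wdot a w = e + nsmult j z"
  proof (rule ccontr)
    assume "\<not> ?thesis"
    then have "wdot a w \<le> d + nsmult j z"
      using assms(1) by (auto simp: zweight_le_def weight_le_def in_keys_iff)
    then show False using that assms(2) by simp
  qed
  then show "Poly_Mapping.lookup (coeff (zpart w z e F) j) a = Poly_Mapping.lookup (coeff 0 j) a"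
    by (simp add: coeff_zpart lookup_hom_part)
qed

lemma zweight_le_mult:
  fixes F G :: "('v, 'k::comm_ring_1) mpoly poly"
  assumes "zweight_le w z d F" "zweight_le w z e G"
  shows "zweight_le w z (d + e) (F * G)"
  unfolding zweight_le_def coeff_mult
proof (intro allI weight_le_sum)
  fix j i :: nat assume "i \<in> {..j}"
  then have "j = i + (j - i)" by simp
  then have "nsmult j z = nsmult i z + nsmult (j - i) z" by (metis nsmult_add)
  then show "weight_le w (d + e + nsmult j z) (coeff F i * coeff G (j - i))"
    using weight_le_mult[of w "d + nsmult i z" "coeff F i" "e + nsmult (j - i) z" "coeff G (j - i)"] assms
    by (simp add: zweight_le_def algebra_simps)
qed

lemma zpart_mult:
  assumes "zweight_le w z d F" "zweight_le w z e G"
  shows "zpart w z (d + e) (F * G) = zpart w z d F * zpart w z e G"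
proof (rule poly_eqI)
  fix j
  have "hom_part w (d + e + nsmult j z) (coeff F i * coeff G (j - i)) =
      hom_part w (d + nsmult i z) (coeff F i) * hom_part w (e + nsmult (j - i) z) (coeff G (j - i))"
    if "i \<le> j" for i
  proof -
    have "j = i + (j - i)" using that by simp
    then have "nsmult j z = nsmult i z + nsmult (j - i) z" by (metis nsmult_add)
    then have "d + e + nsmult j z = (d + nsmult i z) + (e + nsmult (j - i) z)"
      by (simp add: algebra_simps)
    then show ?thesis
      using assms hom_part_mult[of w "d + nsmult i z" "coeff F i" "e + nsmult (j - i) z" "coeff G (j - i)"]
      unfolding zweight_le_def by (simp only:)
  qed
  then show "coeff (zpart w z (d + e) (F * G)) j = coeff (zpart w z d F * zpart w z e G) j"
    by (simp add: coeff_zpart coeff_mult hom_part_sum)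
qed


section \<open>The degenerate homomorphism\<close>

text \<open>
  This is what a \<open>G\<^sub>a\<close>-action provides once the weight of the indeterminate has been chosen: a
  homomorphism to \<open>B[z]\<close> that specialises to the identity at \<open>0\<close> and raises no weight.
\<close>

locale bounded_deformation =
  fixes V :: "'v::linorder set"
    and \<sigma> :: "('v, 'k::idom) mpoly \<Rightarrow> ('v, 'k) mpoly poly"
    and w :: "'v \<Rightarrow> 'g::linordered_ab_group_add"
    and z :: 'g
  assumes Const: "\<sigma> (Const c) = [:Const c:]"
    and add: "p \<in> polys V \<Longrightarrow> q \<in> polys V \<Longrightarrow> \<sigma> (p + q) = \<sigma> p + \<sigma> q"
    and mult: "p \<in> polys V \<Longrightarrow> q \<in> polys V \<Longrightarrow> \<sigma> (p * q) = \<sigma> p * \<sigma> q"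
    and at_zero: "p \<in> polys V \<Longrightarrow> poly (\<sigma> p) 0 = p"
    and bounded: "i \<in> V \<Longrightarrow> zweight_le w z (w i) (\<sigma> (var i))"
begin

abbreviation monomial_image :: "('v \<Rightarrow>\<^sub>0 nat) \<Rightarrow> ('v, 'k) mpoly poly" where
  "monomial_image a \<equiv> \<sigma> (Poly_Mapping.single a 1)"

definition top_image :: "('v \<Rightarrow>\<^sub>0 nat) \<Rightarrow> ('v, 'k) mpoly poly" where
  "top_image a = zpart w z (wdot a w) (monomial_image a)"

text \<open>
  The associated graded map: the linear extension of \<open>x\<^sup>a \<mapsto>\<close> top-weight part of \<open>\<sigma>(x\<^sup>a)\<close>. Working
  monomial by monomial avoids an explicit decomposition of \<open>p\<close> into homogeneous parts.
\<close>

definition \<tau> :: "('v, 'k) mpoly \<Rightarrow> ('v, 'k) mpoly poly" where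
  "\<tau> p = (\<Sum>a\<in>Poly_Mapping.keys p. smult (Const (Poly_Mapping.lookup p a)) (top_image a))"

lemma \<sigma>_sum: "(\<And>x. x \<in> X \<Longrightarrow> p x \<in> polys V) \<Longrightarrow> \<sigma> (\<Sum>x\<in>X. p x) = (\<Sum>x\<in>X. \<sigma> (p x))"
proof (induction X rule: infinite_finite_induct)
  case (insert x X)
  then show ?case by (simp add: add sum_in_polys)
qed (use Const[of 0] in simp_all)

lemma \<sigma>_eq_sum_monomials:
  assumes "p \<in> polys V"
  shows "\<sigma> p = (\<Sum>a\<in>Poly_Mapping.keys p. smult (Const (Poly_Mapping.lookup p a)) (monomial_image a))"
proof -
  have keys: "Poly_Mapping.keys a \<subseteq> V" if "a \<in> Poly_Mapping.keys p" for a
    using assms that by (auto simp: polys_def)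
  have "\<sigma> p = \<sigma> (\<Sum>a\<in>Poly_Mapping.keys p. Const (Poly_Mapping.lookup p a) * Poly_Mapping.single a 1)"
    by (simp only: sum_Const_mult_monomial)
  also have "\<dots> = (\<Sum>a\<in>Poly_Mapping.keys p. \<sigma> (Const (Poly_Mapping.lookup p a) * Poly_Mapping.single a 1))"
    by (intro \<sigma>_sum mult_in_polys Const_in_polys single_in_polys keys)
  also have "\<dots> = (\<Sum>a\<in>Poly_Mapping.keys p. smult (Const (Poly_Mapping.lookup p a)) (monomial_image a))"
    by (intro sum.cong refl) (simp add: mult Const_in_polys single_in_polys keys Const)
  finally show ?thesis .
qed

text \<open>
  Weight bounds add up under products, so the bound on the variables propagates to all monomials.
\<close>

lemma zweight_le_monomial_image:
  "Poly_Mapping.keys a \<subseteq> V \<Longrightarrow> zweight_le w z (wdot a w) (monomial_image a)"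
proof (induction rule: exponent_induct)
  case zero
  have "monomial_image 0 = 1" using Const[of 1] by (simp add: one_pCons)
  then show ?case by (simp add: zweight_le_def weight_le_def coeff_1 when_def)
next
  case (var i)
  then show ?case using bounded by simp
next
  case (add a b)
  have "monomial_image (a + b) = monomial_image a * monomial_image b"
    using mult[of "Poly_Mapping.single a 1" "Poly_Mapping.single b 1"] add
    by (simp add: mult_single single_in_polys)
  then show ?case
    using zweight_le_mult add by (simp add: wdot_add)
qed

lemma top_image_add:
  assumes "Poly_Mapping.keys a \<subseteq> V" "Poly_Mapping.keys b \<subseteq> V"
  shows "top_image (a + b) = top_image a * top_image b"
proof -
  have "monomial_image (a + b) = monomial_image a * monomial_image b"
    using mult[of "Poly_Mapping.single a 1" "Poly_Mapping.single b 1"] assms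
    by (simp add: mult_single single_in_polys)
  then show ?thesis
    using assms by (simp add: top_image_def wdot_add zpart_mult zweight_le_monomial_image)
qed

lemma \<tau>_add: "\<tau> (p + q) = \<tau> p + \<tau> q"
  unfolding \<tau>_def by (rule setsum_keys_plus_distrib) (simp_all add: Const_add smult_add_left)

lemma \<tau>_sum: "\<tau> (\<Sum>x\<in>X. p x) = (\<Sum>x\<in>X. \<tau> (p x))"
  by (induction X rule: infinite_finite_induct) (simp_all add: \<tau>_add, simp_all add: \<tau>_def)

lemma \<tau>_single: "\<tau> (Poly_Mapping.single a c) = smult (Const c) (top_image a)"
  by (simp add: \<tau>_def)

lemma \<tau>_mult:
  assumes "p \<in> polys V" "q \<in> polys V"
  shows "\<tau> (p * q) = \<tau> p * \<tau> q"
proof -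
  have "\<tau> (p * q) = (\<Sum>a\<in>Poly_Mapping.keys p. \<Sum>b\<in>Poly_Mapping.keys q.
     smult (Const (Poly_Mapping.lookup p a * Poly_Mapping.lookup q b)) (top_image (a + b)))"
    by (subst mult_eq_sum_singles) (simp add: \<tau>_sum \<tau>_single)
  also have "\<dots> = \<tau> p * \<tau> q"
    unfolding \<tau>_def sum_product
    using assms by (intro sum.cong refl) (auto simp: polys_def top_image_add Const_mult mult_ac)
  finally show ?thesis .
qed

lemma \<tau>_at_zero:
  assumes "p \<in> polys V"
  shows "coeff (\<tau> p) 0 = p"
proof -
  have "coeff (top_image a) 0 = Poly_Mapping.single a 1" if "a \<in> Poly_Mapping.keys p" for a
    using at_zero[of "Poly_Mapping.single a 1"] assms that
    by (simp add: top_image_def coeff_zpart poly_0_coeff_0 hom_part_single single_in_polys polys_def)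
  then show ?thesis
    by (simp add: \<tau>_def coeff_sum sum_Const_mult_monomial)
qed

lemma \<tau>_Const: "\<tau> (Const c) = [:Const c:]"
proof -
  have "top_image 0 = 1"
    using Const[of 1] zpart_const_poly[of w z 0 "1 :: ('v, 'k) mpoly"] hom_part_single[of w 0 0 "1 :: 'k"]
    by (simp add: top_image_def one_pCons)
  then show ?thesis by (simp add: Const_def \<tau>_single)
qed

definition fixed :: "('v, 'k) mpoly set" where
  "fixed = {p\<in>polys V. \<tau> p = [:p:]}"

text \<open>
  The value of \<open>\<tau> p\<close> at \<open>0\<close> is \<open>p\<close>, so \<open>p\<close> is the only constant that \<open>\<tau> p\<close> can be.
\<close>

lemma fixed_iff_degree: "p \<in> polys V \<Longrightarrow> p \<in> fixed \<longleftrightarrow> degree (\<tau> p) = 0"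
  using \<tau>_at_zero[of p] by (auto simp: fixed_def elim!: degree_eq_zeroE)

lemma subalgebra_gen_subset_fixed:
  assumes "S \<subseteq> fixed"
  shows "subalgebra_gen S \<subseteq> fixed"
proof
  fix p assume "p \<in> subalgebra_gen S"
  then show "p \<in> fixed"
  proof induction
    case (gen g)
    then show ?case using assms by blast
  qed (auto simp: fixed_def \<tau>_Const \<tau>_add \<tau>_mult Const_in_polys add_in_polys mult_in_polys)
qed

text \<open>
  Over a domain the degrees of \<open>\<tau> g\<close> and \<open>\<tau> h\<close> add up to that of \<open>\<tau> (g * h)\<close>, which is \<open>0\<close>.
\<close>

lemma factor_closed_fixed:
  assumes "g * h \<in> fixed" "g * h \<noteq> 0" "g \<in> polys V" "h \<in> polys V"
  shows "g \<in> fixed"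
proof -
  have "degree (\<tau> g * \<tau> h) = 0"
    using assms by (simp add: fixed_iff_degree mult_in_polys flip: \<tau>_mult)
  moreover have "\<tau> g \<noteq> 0" "\<tau> h \<noteq> 0"
    using assms \<tau>_at_zero[of g] \<tau>_at_zero[of h] by auto
  ultimately show ?thesis
    using assms by (simp add: fixed_iff_degree degree_mult_eq)
qed

text \<open>
  Applying \<open>\<tau>\<close> to the relation \<open>q(x) = 0\<close> leaves the coefficients alone and gives \<open>q(\<tau> x) = 0\<close>. A
  polynomial of positive degree over a domain is not a root of a nonzero polynomial with constant
  coefficients, as composition multiplies degrees.
\<close>

lemma algebraically_closed_fixed:
  assumes x: "x \<in> polys V" and q: "q \<noteq> 0" "\<And>j. coeff q j \<in> fixed" "poly q x = 0"
  shows "x \<in> fixed"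
proof -
  have power: "x ^ j \<in> polys V \<and> \<tau> (x ^ j) = \<tau> x ^ j" for j
  proof (induction j)
    case 0
    have "(1 :: ('v, 'k) mpoly) \<in> polys V" "\<tau> 1 = 1"
      using \<tau>_Const[of 1] Const_in_polys[of "1::'k" V] by (simp_all add: one_pCons)
    then show ?case by simp
  next
    case (Suc j)
    then show ?case using x by (simp add: \<tau>_mult mult_in_polys)
  qed
  have "pcompose q (\<tau> x) = (\<Sum>j\<le>degree q. \<tau> (coeff q j * x ^ j))"
  proof -
    have "coeff q j \<in> polys V" "\<tau> (coeff q j) = [:coeff q j:]" for j
      using q(2) by (auto simp: fixed_def)
    then show ?thesis
      by (simp add: pcompose_altdef poly_altdef degree_map_poly coeff_map_poly \<tau>_mult power)
  qed
  also have "\<dots> = \<tau> (poly q x)"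
    by (simp add: poly_altdef \<tau>_sum)
  also have "\<dots> = 0"
    using q(3) by (simp add: \<tau>_def)
  finally have "degree (\<tau> x) = 0"
    using pcompose_eq_0[of q "\<tau> x"] q(1) by blast
  then show ?thesis using x by (simp add: fixed_iff_degree)
qed

text \<open>
  Compare the parts of weight \<open>deg\<^sub>w f\<close> on both sides of \<open>\<sigma> f = f\<close>. On the right this is the initial
  form. On the left, a term of \<open>f\<close> of smaller weight has an image of smaller weight and contributes
  nothing, while a term of maximal weight contributes its image under \<open>\<tau>\<close>.
\<close>

lemma initial_form_fixed:
  assumes f: "f \<in> polys V" "\<sigma> f = [:f:]"
  shows "initial_form w f \<in> fixed"
proof -
  let ?d = "wdeg w f"
  have keys: "Poly_Mapping.keys a \<subseteq> V" if "a \<in> Poly_Mapping.keys f" for a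
    using f that by (auto simp: polys_def)
  have "[:initial_form w f:] = zpart w z ?d (\<sigma> f)"
    by (simp add: f initial_form_eq_hom_part zpart_const_poly)
  also have "\<dots> = (\<Sum>a\<in>Poly_Mapping.keys f. smult (Const (Poly_Mapping.lookup f a))
      (zpart w z ?d (monomial_image a)))"
    by (subst \<sigma>_eq_sum_monomials[OF f(1)]) (simp add: zpart_sum zpart_smult_Const)
  also have "\<dots> = (\<Sum>a\<in>Poly_Mapping.keys f. if wdot a w = ?d
      then smult (Const (Poly_Mapping.lookup f a)) (top_image a) else 0)"
  proof (intro sum.cong refl)
    fix a assume a: "a \<in> Poly_Mapping.keys f"
    have "zpart w z ?d (monomial_image a) = 0" if "wdot a w \<noteq> ?d"
      using zpart_eq_0[OF zweight_le_monomial_image[OF keys[OF a]]] wdot_le_wdeg[OF a, of w] that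
      by simp
    then show "smult (Const (Poly_Mapping.lookup f a)) (zpart w z ?d (monomial_image a)) =
        (if wdot a w = ?d then smult (Const (Poly_Mapping.lookup f a)) (top_image a) else 0)"
      by (auto simp: top_image_def)
  qed
  also have "\<dots> = \<tau> (initial_form w f)"
    by (simp add: initial_form_def \<tau>_sum \<tau>_single flip: sum.inter_filter)
  finally have "\<tau> (initial_form w f) = [:initial_form w f:]" ..
  moreover have "initial_form w f \<in> polys V"
    unfolding initial_form_def by (intro sum_in_polys single_in_polys keys) auto
  ultimately show ?thesis by (simp add: fixed_def)
qed

lemma polys_subset_fixed:
  assumes V: "finite V" "card V = n" "n \<ge> 1"
    and S: "S \<subseteq> fixed" "trdeg (subalgebra_gen S) = enat n"
  shows "polys V \<subseteq> fixed"
proof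
  fix x :: "('v, 'k) mpoly"
  assume x: "x \<in> polys V"
  obtain t where t: "\<And>i. i < n \<Longrightarrow> t i \<in> subalgebra_gen S" "alg_indep {..<n} t"
    using trdeg_attained[OF S(2) V(3)] by blast
  have sub: "subalgebra_gen S \<subseteq> fixed"
    using S(1) by (rule subalgebra_gen_subset_fixed)
  have "t i \<in> polys V" if "i < n" for i
    using t(1)[OF that] sub by (auto simp: fixed_def)
  then have "\<exists>q. q \<noteq> 0 \<and> (\<forall>j. coeff q j \<in> subalgebra_gen (t ` {..<n})) \<and> poly q x = 0"
    using V t(2) x by (intro algebraic_over_independent_family)
  then obtain q where q: "q \<noteq> 0" "\<And>j. coeff q j \<in> subalgebra_gen (t ` {..<n})" "poly q x = 0"
    by blast
  have "subalgebra_gen (t ` {..<n}) \<subseteq> fixed"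
    using t(1) sub by (intro subalgebra_gen_subset_fixed) auto
  then show "x \<in> fixed"
    using algebraically_closed_fixed[OF x q(1) _ q(3)] q(2) by blast
qed

end


section \<open>Choice of the weight of \<open>z\<close>\<close>

text \<open>
  In the divisible hull, \<open>z / N\<close> is the maximum of the quotients \<open>\<delta> / j\<close>. With \<open>N\<close> divisible by every \<open>j\<close>,
  the quotient \<open>N \<delta> / j\<close> is the multiple \<open>(N div j) \<delta>\<close>, an element of the
  group itself.
\<close>

lemma common_slope:
  fixes K :: "(nat \<times> 'g::linordered_ab_group_add) set"
  assumes K: "finite K" "K \<noteq> {}" "\<And>j \<delta>. (j, \<delta>) \<in> K \<Longrightarrow> j \<ge> 1"
  shows "\<exists>N>0. \<exists>z. (\<forall>(j, \<delta>)\<in>K. nsmult N \<delta> \<le> nsmult j z) \<and> (\<exists>(j, \<delta>)\<in>K. nsmult N \<delta> = nsmult j z)"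
proof -
  define N where "N = prod fst K"
  define slope where "slope = (\<lambda>(j, \<delta>). nsmult (N div j) \<delta> :: 'g)"
  define z where "z = Max (slope ` K)"
  have "N > 0"
    unfolding N_def using K(3) by (intro prod_pos) fastforce
  have slope: "nsmult j (slope (j, \<delta>)) = nsmult N \<delta>" if "(j, \<delta>) \<in> K" for j \<delta>
  proof -
    have "j dvd N"
      unfolding N_def using dvd_prodI[OF K(1) that, of fst] by simp
    then show ?thesis by (simp add: slope_def nsmult_nsmult)
  qed
  have "nsmult N \<delta> \<le> nsmult j z" if "(j, \<delta>) \<in> K" for j \<delta>
    unfolding slope[OF that, symmetric] z_def
    using K(1) that by (intro nsmult_mono Max_ge) auto
  moreover have "\<exists>(j, \<delta>)\<in>K. nsmult N \<delta> = nsmult j z"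
  proof -
    have "z \<in> slope ` K"
      unfolding z_def using K by (intro Max_in) auto
    then obtain j \<delta> where "(j, \<delta>) \<in> K" "z = slope (j, \<delta>)" by auto
    then show ?thesis using slope by (intro bexI[of _ "(j, \<delta>)"]) auto
  qed
  ultimately show ?thesis using \<open>N > 0\<close> by blast
qed

section \<open>Non-divisibility of initial forms\<close>

theorem theorem1p3:
  fixes n :: nat
    and f :: "(nat, 'k::idom) mpoly"
    and S :: "(nat, 'k) mpoly set"
    and w :: "nat \<Rightarrow> 'g::linordered_ab_group_add"
  assumes "n \<ge> 1"
    and "f \<noteq> 0"
    and "stable_Ga_invariant n f"
    and "S \<subseteq> polyring n - {0}"
    and "trdeg (subalgebra_gen S) = enat n"
  shows "\<exists>g\<in>S. \<not> (\<exists>h\<in>polyring n. initial_form w f = g * h)"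
proof (rule ccontr)
  assume "\<not> ?thesis"
  then have divides: "\<exists>h\<in>polyring n. initial_form w f = g * h" if "g \<in> S" for g
    using that by blast
  obtain m \<sigma> where f: "f \<in> polyring n" and m: "n \<le> m" and \<sigma>: "Ga_action m \<sigma>"
    and f_inv: "f \<in> Ga_invariants m \<sigma>" and nontrivial: "\<not> polyring n \<subseteq> Ga_invariants m \<sigma>"
    using assms(3) unfolding stable_Ga_invariant_def by blast
  have sub: "polyring n \<subseteq> (polyring m :: (nat, 'k) mpoly set)"
    using m by (intro polys_mono) auto
  have Const: "\<sigma> (Const c) = [:Const c:]" for c
    using \<sigma> by (simp add: Ga_action_def)
  have add: "\<sigma> (p + q) = \<sigma> p + \<sigma> q" and mult: "\<sigma> (p * q) = \<sigma> p * \<sigma> q"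
    and at_zero: "poly (\<sigma> p) 0 = p" if "p \<in> polyring n" "q \<in> polyring n" for p q
    using \<sigma> that(1)[THEN subsetD[OF sub]] that(2)[THEN subsetD[OF sub]]
    unfolding Ga_action_def by blast+
  have var_in: "var i \<in> polyring n" if "i \<in> {1..n}" for i
    using that by (intro single_in_polys) simp
  have \<sigma>_f: "\<sigma> f = [:f:]"
    using f_inv at_zero[OF f f] by (auto simp: Ga_invariants_def)
  \<comment> \<open>\<open>E\<close> lists the terms of positive degree in the images of the variables, and \<open>K\<close> their
    degrees together with the amounts by which the coefficients exceed the weight of the variable.\<close>
  define E where "E = (SIGMA i:{1..n}. SIGMA j:{1..degree (\<sigma> (var i))}. Poly_Mapping.keys (coeff (\<sigma> (var i)) j))"
  define K where "K = (\<lambda>(i, j, b). (j, wdot b w - w i)) ` E"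
  \<comment> \<open>The maximum over \<open>K\<close> exists because an action that fixes all variables fixes \<open>k[x]\<close>.\<close>
  have "\<exists>i\<in>{1..n}. degree (\<sigma> (var i)) > 0"
  proof (rule ccontr)
    assume "\<not> ?thesis"
    then have degree: "degree (\<sigma> (var i)) = 0" if "i \<in> {1..n}" for i
      using that by (meson gr0I)
    have var: "\<sigma> (var i) = [:var i:]" if i: "i \<in> {1..n}" for i
    proof -
      obtain b where "\<sigma> (var i) = [:b:]"
        using degree[OF i] by (rule degree_eq_zeroE)
      then show ?thesis
        using at_zero[OF var_in[OF i] var_in[OF i]] by simp
    qed
    have "\<sigma> p = [:p:]" if "p \<in> polyring n" for p
      using that
    proof (induction rule: polys_induct)
      case (var i)
      then show ?case by (rule \<open>\<And>i. i \<in> {1..n} \<Longrightarrow> \<sigma> (var i) = [:var i:]\<close>)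
    qed (simp_all add: Const add mult)
    then show False
      using nontrivial sub by (auto simp: Ga_invariants_def)
  qed
  then have "E \<noteq> {}"
  proof
    fix i assume i: "i \<in> {1..n}" "degree (\<sigma> (var i)) > 0"
    then have "coeff (\<sigma> (var i)) (degree (\<sigma> (var i))) \<noteq> 0" by auto
    then obtain b where "b \<in> Poly_Mapping.keys (coeff (\<sigma> (var i)) (degree (\<sigma> (var i))))"
      by (meson all_not_in_conv keys_eq_empty)
    then have "(i, degree (\<sigma> (var i)), b) \<in> E"
      using i by (simp add: E_def)
    then show ?thesis by blast
  qed
  then have K_nonempty: "K \<noteq> {}" by (simp add: K_def)
  have "finite E" unfolding E_def by (intro finite_SigmaI) auto
  then have K_finite: "finite K" by (simp add: K_def)
  have K_pos: "j \<ge> 1" if "(j, \<delta>) \<in> K" for j \<delta>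
    using that by (auto simp: K_def E_def)
  have "\<exists>N>0. \<exists>z. (\<forall>(j, \<delta>)\<in>K. nsmult N \<delta> \<le> nsmult j z) \<and> (\<exists>(j, \<delta>)\<in>K. nsmult N \<delta> = nsmult j z)"
    by (rule common_slope[OF K_finite K_nonempty]) (rule K_pos)
  then obtain N z where N: "N > 0" and z: "\<forall>(j, \<delta>)\<in>K. nsmult N \<delta> \<le> nsmult j z"
    and attained: "\<exists>(j, \<delta>)\<in>K. nsmult N \<delta> = nsmult j z"
    by (elim exE conjE) (rule that)
  from attained obtain i0 j0 b0 where E0: "(i0, j0, b0) \<in> E"
    and z0: "nsmult N (wdot b0 w - w i0) = nsmult j0 z"
    unfolding K_def by force
  define w' where "w' = (\<lambda>i. nsmult N (w i))"
  have w'_var: "w' i = nsmult N (w i)" and wdot_w': "wdot b w' = nsmult N (wdot b w)" for i b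
    by (simp_all add: w'_def wdot_scale)
  interpret bounded_deformation "{1..n}" \<sigma> w' z
  proof unfold_locales
    fix i assume i: "i \<in> {1..n}"
    show "zweight_le w' z (w' i) (\<sigma> (var i))"
      unfolding zweight_le_def weight_le_def
    proof safe
      fix j b assume b: "b \<in> Poly_Mapping.keys (coeff (\<sigma> (var i)) j)"
      show "wdot b w' \<le> w' i + nsmult j z"
      proof (cases "j = 0")
        case True
        then have "b = Poly_Mapping.single i 1"
          using b at_zero[OF var_in[OF i] var_in[OF i]] by (simp add: poly_0_coeff_0)
        then show ?thesis using True by simp
      next
        case False
        moreover have "j \<le> degree (\<sigma> (var i))"
          using b by (intro le_degree) auto
        ultimately have "(i, j, b) \<in> E"
          using i b by (simp add: E_def)
        then have "(j, wdot b w - w i) \<in> K"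
          by (force simp: K_def)
        with z have "nsmult N (wdot b w - w i) \<le> nsmult j z" by blast
        then show ?thesis
          by (simp add: nsmult_diff wdot_w' w'_var algebra_simps)
      qed
    qed
  qed (simp_all add: Const add mult at_zero)
  have form_fixed: "initial_form w f \<in> fixed"
    using initial_form_fixed[OF f \<sigma>_f] N by (simp add: w'_def initial_form_scale)
  have form_nonzero: "initial_form w f \<noteq> 0"
    using assms(2) by (rule initial_form_nonzero)
  have "S \<subseteq> fixed"
  proof (intro subsetI)
    fix g assume g: "g \<in> S"
    then obtain h where "h \<in> polyring n" "initial_form w f = g * h"
      using divides by blast
    then show "g \<in> fixed"
      using form_fixed form_nonzero g assms(4)
      by (intro factor_closed_fixed[of g h]) auto
  qed
  then have "polyring n \<subseteq> fixed"
    using assms(1,5) by (intro polys_subset_fixed) auto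
  \<comment> \<open>The term attaining the maximal slope survives in the image of its variable under \<open>\<tau>\<close>.\<close>
  moreover have i0: "i0 \<in> {1..n}" "j0 \<ge> 1" "b0 \<in> Poly_Mapping.keys (coeff (\<sigma> (var i0)) j0)"
    using E0 by (auto simp: E_def)
  ultimately have "\<tau> (var i0) = [:var i0:]"
    using var_in[of i0] unfolding fixed_def by blast
  then have "coeff (\<tau> (var i0)) j0 = 0"
    using i0 by (cases j0) auto
  moreover have "\<tau> (var i0) = zpart w' z (w' i0) (\<sigma> (var i0))"
    by (simp add: \<tau>_single top_image_def)
  moreover have "wdot b0 w' = w' i0 + nsmult j0 z"
    by (simp add: wdot_w' w'_var nsmult_diff flip: z0)
  ultimately have "Poly_Mapping.lookup (coeff (\<sigma> (var i0)) j0) b0 = 0"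
    by (metis coeff_zpart lookup_hom_part lookup_zero)
  then show False
    using i0 by (simp add: in_keys_iff)
qed

end
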